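(* Let $\xi_0,\xi_1,\dots,\xi_N$ be real numbers such that $0<\delta\le|\xi_m-\xi_n|$ whenever $m\ne n$. Let $a_0,a_1,\dots,a_N$ be complex numbers. If $0<\sigma<1$ then $$-\frac{(2-2^{2-\sigma})\zeta(\sigma)}{\delta^\sigma}\sum_{n=0}^N|a_n|^2\le\sum_{m=0}^N\ \sum_{0\le n\le N,\ n\ne m}\frac{a_m\overline{a}_n}{|\xi_m-\xi_n|^\sigma},$$ if $\sigma=1$ then $$-\frac{\log4}{\delta}\sum_{n=0}^N|a_n|^2\le\sum_{m=0}^N\ \sum_{0\le n\le N,\ n\ne m}\frac{a_m\overline{a}_n}{|\xi_m-\xi_n|},$$ and if $1<\sigma<2$ then $$-\frac{(2-2^{2-\sigma})\zeta(\sigma)}{\delta^\sigma}\sum_{n=0}^N|a_n|^2\le\sum_{m=0}^N\ \sum_{0\le n\le N,\ n\ne m}\frac{a_m\overline{a}_n}{|\xi_m-\xi_n|^\sigma}\le\frac{2\zeta(\sigma)}{\delta^\sigma}\sum_{n=0}^N|a_n|^2.$$ The constants occurring in these inequalities are sharp.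
   Context: $\zeta$ denotes the Riemann zeta-function (analytically continued), $\overline{a}_n$ the complex conjugate of $a_n$, and $N$ an arbitrary nonnegative integer. Sharpness is understood for fixed $\sigma$ and $\delta$, with the inequality required to hold for all $N$, all $\delta$-separated $\xi_0,\dots,\xi_N$ and all $a_0,\dots,a_N$: the positive numbers $(2-2^{2-\sigma})\zeta(\sigma)\delta^{-\sigma}$, $\delta^{-1}\log4$ and $2\zeta(\sigma)\delta^{-\sigma}$ cannot be replaced by smaller numbers in the respective inequalities. *)

theory Defs
  imports "HOL-Analysis.Analysis" "HOL-Library.Complex_Order"
begin

text \<open>The Riemann zeta-function is the analytic continuation of the Dirichlet series to the
  complex plane without 1. The identity theorem makes the continuation unique on that domain;
  only the value at 1 is left unspecified.\<close>

definition riemann_zeta :: "complex \<Rightarrow> complex" where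
  "riemann_zeta = (SOME f. f holomorphic_on - {1} \<and>
     (\<forall>s. Re s > 1 \<longrightarrow> (\<lambda>n. 1 / of_nat (Suc n) powr s) sums f s))"

text \<open>The zeta-function is real at real arguments other than 1, so taking the real part only
  changes the type.\<close>

definition real_zeta :: "real \<Rightarrow> real" where
  "real_zeta \<sigma> = Re (riemann_zeta (of_real \<sigma>))"

definition separated :: "real \<Rightarrow> nat \<Rightarrow> (nat \<Rightarrow> real) \<Rightarrow> bool" where
  "separated \<delta> N \<xi> \<longleftrightarrow> (\<forall>m\<le>N. \<forall>n\<le>N. m \<noteq> n \<longrightarrow> \<delta> \<le> \<bar>\<xi> m - \<xi> n\<bar>)"

definition hilbert_form :: "real \<Rightarrow> nat \<Rightarrow> (nat \<Rightarrow> real) \<Rightarrow> (nat \<Rightarrow> complex) \<Rightarrow> complex" where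
  "hilbert_form \<sigma> N \<xi> a =
     (\<Sum>m\<le>N. \<Sum>n\<in>{..N} - {m}. a m * cnj (a n) / of_real (\<bar>\<xi> m - \<xi> n\<bar> powr \<sigma>))"

text \<open>The order on the complex numbers is that of \<^theory>\<open>HOL-Library.Complex_Order\<close>:
  the real parts are compared and the imaginary parts agree. The inequalities below therefore
  include the assertion that the form is real.\<close>

definition hilbert_lower_bound :: "real \<Rightarrow> real \<Rightarrow> real \<Rightarrow> bool" where
  "hilbert_lower_bound \<sigma> \<delta> C \<longleftrightarrow>
     (\<forall>N \<xi> a. separated \<delta> N \<xi> \<longrightarrow>
        of_real (- C * (\<Sum>n\<le>N. (cmod (a n))\<^sup>2)) \<le> hilbert_form \<sigma> N \<xi> a)"

definition hilbert_upper_bound :: "real \<Rightarrow> real \<Rightarrow> real \<Rightarrow> bool" where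
  "hilbert_upper_bound \<sigma> \<delta> C \<longleftrightarrow>
     (\<forall>N \<xi> a. separated \<delta> N \<xi> \<longrightarrow>
        hilbert_form \<sigma> N \<xi> a \<le> of_real (C * (\<Sum>n\<le>N. (cmod (a n))\<^sup>2)))"

definition sharp_constant :: "(real \<Rightarrow> bool) \<Rightarrow> real \<Rightarrow> bool" where
  "sharp_constant P C \<longleftrightarrow> C > 0 \<and> P C \<and> (\<forall>C'<C. \<not> P C')"

end

theory Submission
  imports Defs "HOL-Complex_Analysis.Complex_Analysis" "HOL-Real_Asymp.Real_Asymp"
begin

text \<open>The kernel \<open>E t = exp (- s \<bar>t\<bar>)\<close> is positive definite, hence so is
  \<open>2 E t + \<epsilon> (E (t - \<delta>) + E (t + \<delta>))\<close> for \<open>\<epsilon> = 1\<close> and \<open>\<epsilon> = - 1\<close>, since it arises from \<open>E\<close> by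
  attaching the coefficient \<open>\<epsilon> a\<^sub>n\<close> to the additional point \<open>\<xi>\<^sub>n + \<delta>\<close>. For \<open>\<bar>t\<bar> \<ge> \<delta>\<close> it is a multiple
  of \<open>E t\<close>, which gives a sharp bound for the form with kernel \<open>E\<close>: with \<open>q = exp (- s \<delta>)\<close> the
  constant is \<open>2 q / (1 + \<epsilon> q)\<close>. Integrating against \<open>s powr (\<sigma> - 1)\<close> turns \<open>E t\<close> into a multiple of
  \<open>\<bar>t\<bar> powr - \<sigma>\<close> and the geometric series of \<open>q\<close> into \<open>2 \<Sum> (- \<epsilon>)\<^sup>k (k + 1) powr - \<sigma> / \<delta> powr \<sigma>\<close>.
  Equality holds in the limit for \<open>\<xi>\<^sub>n = n \<delta>\<close> and \<open>a\<^sub>n = (- \<epsilon>)\<^sup>n\<close>.\<close>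

section \<open>Exponential kernels\<close>

lemma sum_Re_mult_cnj:
  fixes c :: "'i \<Rightarrow> complex"
  assumes "finite I"
  shows "(\<Sum>i\<in>I. \<Sum>j\<in>I. Re (c i * cnj (c j))) = (cmod (\<Sum>i\<in>I. c i))\<^sup>2"
proof -
  have "complex_of_real ((cmod (\<Sum>i\<in>I. c i))\<^sup>2) = (\<Sum>i\<in>I. \<Sum>j\<in>I. c i * cnj (c j))"
    by (simp only: complex_norm_square cnj_sum sum_product)
  then have "Re (\<Sum>i\<in>I. \<Sum>j\<in>I. c i * cnj (c j)) = (cmod (\<Sum>i\<in>I. c i))\<^sup>2"
    by (metis Re_complex_of_real)
  then show ?thesis
    by simp
qed

text \<open>\<open>min (u i) (u j)\<close> is the L^2 inner product of the indicators of
  \<open>{0..u i}\<close> and \<open>{0..u j}\<close>. The form is therefore the integral of the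
  squared modulus of the sum of the step functions \<open>h i\<close>.\<close>

lemma min_kernel_nonneg:
  fixes c :: "'i \<Rightarrow> complex" and u :: "'i \<Rightarrow> real"
  assumes "finite I" and u: "\<And>i. i \<in> I \<Longrightarrow> 0 \<le> u i"
  shows "0 \<le> (\<Sum>i\<in>I. \<Sum>j\<in>I. Re (c i * cnj (c j)) * min (u i) (u j))"
proof -
  define h where "h = (\<lambda>i x. if x \<in> {0..u i} then c i else 0)"
  have int: "((\<lambda>x. Re (h i x * cnj (h j x))) has_integral Re (c i * cnj (c j)) * min (u i) (u j)) UNIV"
    if "i \<in> I" "j \<in> I" for i j
  proof -
    have "((\<lambda>x. Re (c i * cnj (c j))) has_integral Re (c i * cnj (c j)) * min (u i) (u j))
            {0..min (u i) (u j)}"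
      using has_integral_const_real[of "Re (c i * cnj (c j))" 0 "min (u i) (u j)"] u that
      by (simp add: mult.commute)
    then have "((\<lambda>x. if x \<in> {0..min (u i) (u j)} then Re (c i * cnj (c j)) else 0) has_integral
                 Re (c i * cnj (c j)) * min (u i) (u j)) UNIV"
      by (simp only: has_integral_restrict_UNIV)
    then show ?thesis
      by (rule has_integral_eq[rotated]) (auto simp: h_def)
  qed
  have "((\<lambda>x. \<Sum>i\<in>I. \<Sum>j\<in>I. Re (h i x * cnj (h j x))) has_integral
          (\<Sum>i\<in>I. \<Sum>j\<in>I. Re (c i * cnj (c j)) * min (u i) (u j))) UNIV"
    by (intro has_integral_sum assms int)
  then show ?thesis
    by (rule has_integral_nonneg) (simp only: sum_Re_mult_cnj[OF \<open>finite I\<close>] zero_le_power2)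
qed

text \<open>For p \<le> q the exponent -s(q - p) is -sp - sq + 2sp. The kernel is thus a minimum of
  two increasing exponentials times one factor in p and one in q, and the coefficients absorb these
  factors.\<close>

lemma exp_kernel_nonneg:
  fixes c :: "'i \<Rightarrow> complex" and x :: "'i \<Rightarrow> real"
  assumes "finite I" "0 \<le> s"
  shows "0 \<le> (\<Sum>i\<in>I. \<Sum>j\<in>I. Re (c i * cnj (c j)) * exp (- s * \<bar>x i - x j\<bar>))"
proof -
  have eq: "exp (- s * \<bar>p - q\<bar>) = exp (- s * p) * exp (- s * q) * min (exp (2 * s * p)) (exp (2 * s * q))"
    for p q :: real
    using \<open>0 \<le> s\<close>
  proof (induction p q rule: linorder_wlog)
    case (le p q)
    then have "2 * s * p \<le> 2 * s * q"
      by (simp add: mult_left_mono)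
    with le show ?case
      by (simp add: min_def flip: exp_add) (simp add: algebra_simps)
  next
    case (sym p q)
    then show ?case
      by (simp add: abs_minus_commute min.commute mult.commute)
  qed
  have "0 \<le> (\<Sum>i\<in>I. \<Sum>j\<in>I. Re ((exp (- s * x i) * c i) * cnj (exp (- s * x j) * c j)) *
               min (exp (2 * s * x i)) (exp (2 * s * x j)))"
    by (rule min_kernel_nonneg) (simp_all add: assms)
  also have "\<dots> = (\<Sum>i\<in>I. \<Sum>j\<in>I. Re (c i * cnj (c j)) * exp (- s * \<bar>x i - x j\<bar>))"
    by (intro sum.cong refl, simp only: eq) (simp add: algebra_simps)
  finally show ?thesis .
qed

text \<open>The shifted exponentials combine to \<open>\<epsilon> (1 + \<epsilon> q)\<^sup>2 / q\<close> times the original one outside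
  \<open>(- \<delta>, \<delta>)\<close>, where \<open>q = exp (- s \<delta>)\<close>; this is where the separation of the points enters.\<close>

lemma exp_form_bound:
  fixes a :: "nat \<Rightarrow> complex"
  assumes sep: "separated \<delta> N \<xi>" and "\<delta> > 0" "s > 0" and \<epsilon>: "\<epsilon> = 1 \<or> \<epsilon> = (-1::real)"
  shows "0 \<le> \<epsilon> * (\<Sum>m\<le>N. \<Sum>n\<in>{..N} - {m}. Re (a m * cnj (a n)) * exp (- s * \<bar>\<xi> m - \<xi> n\<bar>))
             + 2 * exp (- s * \<delta>) / (1 + \<epsilon> * exp (- s * \<delta>)) * (\<Sum>n\<le>N. (cmod (a n))\<^sup>2)"
    (is "0 \<le> \<epsilon> * ?F + _ * ?A")
proof -
  define q where "q = exp (- s * \<delta>)"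
  have q: "0 < q" "q < 1"
    using assms by (simp_all add: q_def)
  define E where "E = (\<lambda>t::real. exp (- s * \<bar>t\<bar>))"
  define G where "G = (\<lambda>t. 2 * E t + \<epsilon> * (E (t - \<delta>) + E (t + \<delta>)))"
  define c where "c = (\<lambda>(m, b). if b then of_real \<epsilon> * a m else a m)"
  define x where "x = (\<lambda>(m, b). if b then \<xi> m + \<delta> else \<xi> m)"
  have E_minus: "E (- t) = E t" for t
    by (simp add: E_def)
  have "0 \<le> (\<Sum>i\<in>{..N}\<times>UNIV. \<Sum>j\<in>{..N}\<times>UNIV. Re (c i * cnj (c j)) * E (x i - x j))"
    unfolding E_def by (rule exp_kernel_nonneg) (use \<open>s > 0\<close> in auto)
  also have "\<dots> = (\<Sum>m\<le>N. \<Sum>n\<le>N. Re (a m * cnj (a n)) * G (\<xi> m - \<xi> n))"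
    using \<epsilon>
    by (auto simp: sum.cartesian_product' UNIV_bool c_def x_def G_def sum.distrib[symmetric]
        algebra_simps intro!: sum.cong)
  also have "\<dots> = (\<Sum>m\<le>N. (2 + 2 * \<epsilon> * q) * (cmod (a m))\<^sup>2 +
                   \<epsilon> * (1 + \<epsilon> * q)\<^sup>2 / q * (\<Sum>n\<in>{..N}-{m}. Re (a m * cnj (a n)) * E (\<xi> m - \<xi> n)))"
  proof (rule sum.cong)
    fix m assume m: "m \<in> {..N}"
    have G0: "G 0 = 2 + 2 * \<epsilon> * q"
      using \<open>\<delta> > 0\<close> by (simp add: G_def E_def q_def)
    have Gt: "G t = \<epsilon> * (1 + \<epsilon> * q)\<^sup>2 / q * E t" if t: "\<delta> \<le> \<bar>t\<bar>" for t
    proof -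
      \<comment> \<open>For u \<ge> \<delta> neither shift crosses 0, so the absolute values
        disappear. Negative t reduces to this case because \<open>E\<close> is even.\<close>
      have *: "E (u - \<delta>) = E u / q" "E (u + \<delta>) = E u * q" if "\<delta> \<le> u" for u
        using that \<open>\<delta> > 0\<close> by (simp_all add: E_def q_def algebra_simps exp_minus exp_add exp_diff divide_simps)
      have "E (t - \<delta>) + E (t + \<delta>) = E t / q + E t * q"
      proof (cases "t \<ge> 0")
        case True
        with t * show ?thesis by simp
      next
        case False
        with t have "\<delta> \<le> - t" by simp
        from *[OF this] show ?thesis
          using E_minus[of "- t + \<delta>"] E_minus[of "- t - \<delta>"] E_minus[of t]
          by (simp add: add.commute)
      qed
      \<comment> \<open>As \<epsilon>^2 = 1, 2 + \<epsilon> (1/q + q) = \<epsilon> (1 + \<epsilon>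
        q)^2 / q.\<close>
      with \<epsilon> q show ?thesis
        by (auto simp: G_def field_simps power2_eq_square)
    qed
    have "(\<Sum>n\<le>N. Re (a m * cnj (a n)) * G (\<xi> m - \<xi> n)) =
          Re (a m * cnj (a m)) * G 0 + (\<Sum>n\<in>{..N}-{m}. Re (a m * cnj (a n)) * G (\<xi> m - \<xi> n))"
      using m by (subst sum.remove[of _ m]) auto
    also have "Re (a m * cnj (a m)) = (cmod (a m))\<^sup>2"
      by (simp add: complex_mult_cnj cmod_power2)
    also have "(\<Sum>n\<in>{..N}-{m}. Re (a m * cnj (a n)) * G (\<xi> m - \<xi> n)) =
               (\<Sum>n\<in>{..N}-{m}. \<epsilon> * (1 + \<epsilon> * q)\<^sup>2 / q * (Re (a m * cnj (a n)) * E (\<xi> m - \<xi> n)))"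
    proof (rule sum.cong)
      fix n assume "n \<in> {..N} - {m}"
      with m sep have "\<delta> \<le> \<bar>\<xi> m - \<xi> n\<bar>"
        by (auto simp: separated_def)
      from Gt[OF this] show "Re (a m * cnj (a n)) * G (\<xi> m - \<xi> n) =
          \<epsilon> * (1 + \<epsilon> * q)\<^sup>2 / q * (Re (a m * cnj (a n)) * E (\<xi> m - \<xi> n))"
        by (simp only: mult.left_commute)
    qed simp
    finally show "(\<Sum>n\<le>N. Re (a m * cnj (a n)) * G (\<xi> m - \<xi> n)) =
        (2 + 2 * \<epsilon> * q) * (cmod (a m))\<^sup>2 +
        \<epsilon> * (1 + \<epsilon> * q)\<^sup>2 / q * (\<Sum>n\<in>{..N}-{m}. Re (a m * cnj (a n)) * E (\<xi> m - \<xi> n))"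
      by (simp add: G0 sum_distrib_left)
  qed simp
  also have "\<dots> = (2 + 2 * \<epsilon> * q) * ?A + \<epsilon> * (1 + \<epsilon> * q)\<^sup>2 / q * ?F"
    by (simp add: sum.distrib sum_distrib_left E_def)
  \<comment> \<open>The factor pulled out is positive because 0 < q < 1, so it can be cancelled; the
    diagonal weight 2 (1 + \<epsilon> q) leaves the constant 2 q / (1 + \<epsilon> q).\<close>
  also have "\<dots> = (1 + \<epsilon> * q)\<^sup>2 / q * (\<epsilon> * ?F + 2 * q / (1 + \<epsilon> * q) * ?A)"
    using q \<epsilon> by (auto simp: divide_simps power2_eq_square) (simp_all add: algebra_simps)
  finally have "0 \<le> (1 + \<epsilon> * q)\<^sup>2 / q * (\<epsilon> * ?F + 2 * q / (1 + \<epsilon> * q) * ?A)" .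
  moreover have "0 < (1 + \<epsilon> * q)\<^sup>2 / q"
    using q \<epsilon> by auto
  ultimately show ?thesis
    by (simp only: zero_le_mult_iff q_def) linarith
qed

text \<open>The Gamma integral under the substitution t = d s.\<close>

lemma Mellin_exp:
  fixes \<sigma> d :: real
  assumes "\<sigma> > 0" "d > 0"
  shows "has_bochner_integral lborel (\<lambda>s. indicator {0..} s * s powr (\<sigma> - 1) * exp (- s * d))
           (Gamma \<sigma> * d powr - \<sigma>)"
proof -
  have "has_bochner_integral lborel (\<lambda>t. indicator {0..} t * t powr (\<sigma> - 1) / exp t) (Gamma \<sigma>)"
    using \<open>\<sigma> > 0\<close>
    by (intro has_bochner_integral_nn_integral Gamma_conv_nn_integral_real[symmetric])
       (simp_all add: Gamma_real_pos less_imp_le)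
  from lborel_has_bochner_integral_real_affine_iff[THEN iffD1, OF _ this, of d 0] \<open>d > 0\<close>
  have "has_bochner_integral lborel
          (\<lambda>s. indicator {0..} (d * s) * (d * s) powr (\<sigma> - 1) / exp (d * s)) (Gamma \<sigma> / d)"
    by (simp add: divide_inverse mult.commute)
  from has_bochner_integral_mult_left[OF this, of "d powr (1 - \<sigma>)"]
  have "has_bochner_integral lborel
          (\<lambda>s. indicator {0..} (d * s) * (d * s) powr (\<sigma> - 1) / exp (d * s) * d powr (1 - \<sigma>))
          (Gamma \<sigma> / d * d powr (1 - \<sigma>))"
    by simp
  also have "Gamma \<sigma> / d * d powr (1 - \<sigma>) = Gamma \<sigma> * d powr - \<sigma>"
    using \<open>d > 0\<close> by (simp add: powr_diff powr_minus divide_simps)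
  also have "(\<lambda>s. indicator {0..} (d * s) * (d * s) powr (\<sigma> - 1) / exp (d * s) * d powr (1 - \<sigma>)) =
             (\<lambda>s. indicator {0..} s * s powr (\<sigma> - 1) * exp (- s * d))"
    using \<open>d > 0\<close>
    by (auto simp: fun_eq_iff indicator_def powr_mult powr_diff exp_minus field_simps zero_le_mult_iff)
  finally show ?thesis .
qed

section \<open>Bounds for the form\<close>

lemma Re_hilbert_form:
  "Re (hilbert_form \<sigma> N \<xi> a) =
     (\<Sum>m\<le>N. \<Sum>n\<in>{..N}-{m}. Re (a m * cnj (a n)) * \<bar>\<xi> m - \<xi> n\<bar> powr - \<sigma>)"
  unfolding hilbert_form_def
  by (simp add: powr_minus_divide)

text \<open>Conjugation exchanges the roles of m and n, and the distances are symmetric. The order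
  on the complex numbers compares only numbers with equal imaginary parts, so this is part of the
  inequalities.\<close>

lemma Im_hilbert_form: "Im (hilbert_form \<sigma> N \<xi> a) = 0"
proof -
  have "cnj (hilbert_form \<sigma> N \<xi> a) =
          (\<Sum>m\<le>N. \<Sum>n\<in>{..N}-{m}. a n * cnj (a m) / of_real (\<bar>\<xi> n - \<xi> m\<bar> powr \<sigma>))"
    by (simp add: hilbert_form_def abs_minus_commute mult.commute)
  also have "\<dots> = (\<Sum>(m, n)\<in>Sigma {..N} (\<lambda>m. {..N}-{m}). a n * cnj (a m) / of_real (\<bar>\<xi> n - \<xi> m\<bar> powr \<sigma>))"
    by (subst sum.Sigma) auto
  also have "\<dots> = (\<Sum>(m, n)\<in>Sigma {..N} (\<lambda>m. {..N}-{m}). a m * cnj (a n) / of_real (\<bar>\<xi> m - \<xi> n\<bar> powr \<sigma>))"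
    by (rule sum.reindex_bij_witness[of _ prod.swap prod.swap]) auto
  also have "\<dots> = hilbert_form \<sigma> N \<xi> a"
    unfolding hilbert_form_def by (subst sum.Sigma) auto
  finally show ?thesis
    by (metis Reals_cnj_iff complex_is_Real_iff)
qed

text \<open>The last term, \<open>B exp (- s D) / s\<close>, absorbs the tail of a geometric series.\<close>

lemma Mellin_nonneg:
  fixes c d :: "'i \<Rightarrow> real"
  assumes "finite J" "\<sigma> > 0" "\<And>j. j \<in> J \<Longrightarrow> d j > 0" "D > 0" "B = 0 \<or> \<sigma> > 1"
    and nonneg: "\<And>s. s > 0 \<Longrightarrow> 0 \<le> (\<Sum>j\<in>J. c j * exp (- s * d j)) + B * exp (- s * D) / s"
  shows "0 \<le> (\<Sum>j\<in>J. c j * d j powr - \<sigma>) + B * D powr (1 - \<sigma>) / (\<sigma> - 1)"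
proof -
  let ?w = "\<lambda>s. indicator {0..} s * s powr (\<sigma> - 1) :: real"
  have 1: "has_bochner_integral lborel (\<lambda>s. \<Sum>j\<in>J. c j * (?w s * exp (- s * d j)))
          (\<Sum>j\<in>J. c j * (Gamma \<sigma> * d j powr - \<sigma>))"
    by (intro has_bochner_integral_sum has_bochner_integral_mult_right Mellin_exp assms)
  have 2: "has_bochner_integral lborel
          (\<lambda>s. B * (indicator {0..} s * s powr (\<sigma> - 1 - 1) * exp (- s * D)))
          (B * (Gamma (\<sigma> - 1) * D powr - (\<sigma> - 1)))"
  \<comment> \<open>The Mellin integral at \<sigma> - 1 exists only for \<sigma> > 1; when B = 0
    both sides vanish whatever \<open>Gamma (\<sigma> - 1)\<close> is.\<close>
  proof (cases "B = 0")
    case False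
    with assms have "\<sigma> - 1 > 0"
      by simp
    then show ?thesis
      by (intro has_bochner_integral_mult_right Mellin_exp assms)
  qed (simp add: has_bochner_integral_zero)
  define h where "h = (\<lambda>s. (\<Sum>j\<in>J. c j * (?w s * exp (- s * d j))) +
                  B * (indicator {0..} s * s powr (\<sigma> - 1 - 1) * exp (- s * D)))"
  have "0 \<le> h s" for s
  proof -
    \<comment> \<open>For s < 0 the indicator vanishes, and at s = 0 the weight vanishes because
      \<open>0 powr x = 0\<close>.\<close>
    have "0 \<le> ?w s * ((\<Sum>j\<in>J. c j * exp (- s * d j)) + B * exp (- s * D) / s)"
      using nonneg[of s] by (cases "s > 0") (auto simp: indicator_def)
    also have "\<dots> = h s"
      unfolding h_def by (cases "s > 0")
         (auto simp: indicator_def powr_diff sum_distrib_left sum_divide_distrib field_simps power2_eq_square)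
    finally show ?thesis .
  qed
  then have "0 \<le> (\<integral>s. h s \<partial>lborel)"
    by simp
  also have "\<dots> = (\<Sum>j\<in>J. c j * (Gamma \<sigma> * d j powr - \<sigma>)) + B * (Gamma (\<sigma> - 1) * D powr - (\<sigma> - 1))"
    unfolding h_def by (rule has_bochner_integral_integral_eq[OF has_bochner_integral_add[OF 1 2]])
  \<comment> \<open>The recurrence of Gamma makes \<open>Gamma \<sigma>\<close> a common positive
    factor of both parts.\<close>
  also have "B * (Gamma (\<sigma> - 1) * D powr - (\<sigma> - 1)) = Gamma \<sigma> * (B * D powr (1 - \<sigma>) / (\<sigma> - 1))"
  proof (cases "B = 0")
    case False
    with assms have "Gamma \<sigma> = (\<sigma> - 1) * Gamma (\<sigma> - 1)" "\<sigma> > 1"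
      using Gamma_plus1[of "\<sigma> - 1"] by (auto simp: nonpos_Ints_def)
    then show ?thesis
      by simp
  qed simp
  also have "(\<Sum>j\<in>J. c j * (Gamma \<sigma> * d j powr - \<sigma>)) = Gamma \<sigma> * (\<Sum>j\<in>J. c j * d j powr - \<sigma>)"
    by (simp add: sum_distrib_left mult_ac)
  finally have "0 \<le> Gamma \<sigma> * ((\<Sum>j\<in>J. c j * d j powr - \<sigma>) + B * D powr (1 - \<sigma>) / (\<sigma> - 1))"
    by (simp add: distrib_left)
  with Gamma_real_pos[OF \<open>\<sigma> > 0\<close>] show ?thesis
    by (simp add: zero_le_mult_iff)
qed

text \<open>For \<open>\<epsilon> = 1\<close> and odd \<open>K\<close> the geometric partial sums already dominate \<open>q / (1 + q)\<close>, so \<open>b = 0\<close>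
  suffices; for \<open>\<epsilon> = - 1\<close> the tail is at most \<open>q ^ K / (s \<delta>)\<close>.\<close>

lemma hilbert_form_bound:
  fixes a :: "nat \<Rightarrow> complex"
  assumes sep: "separated \<delta> N \<xi>" and "\<delta> > 0" "\<sigma> > 0" "K > 0"
    and \<epsilon>: "\<epsilon> = 1 \<and> odd K \<and> b = 0 \<or> \<epsilon> = (-1::real) \<and> \<sigma> > 1 \<and> b = 1"
  shows "0 \<le> \<epsilon> * Re (hilbert_form \<sigma> N \<xi> a) + 2 / \<delta> powr \<sigma> * 
             ((\<Sum>k<K. (- \<epsilon>) ^ k * real (Suc k) powr - \<sigma>) + b * real K powr (1 - \<sigma>) / (\<sigma> - 1)) *
             (\<Sum>n\<le>N. (cmod (a n))\<^sup>2)"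
proof -
  define A where "A = (\<Sum>n\<le>N. (cmod (a n))\<^sup>2)"
  define P where "P = Sigma {..N} (\<lambda>m. {..N} - {m})"
  define J where "J = Inl ` P \<union> Inr ` {..<K}"
  define c where "c = case_sum (\<lambda>(m, n). \<epsilon> * Re (a m * cnj (a n))) (\<lambda>k. 2 * A * (- \<epsilon>) ^ k)"
  define d where "d = case_sum (\<lambda>(m, n). \<bar>\<xi> m - \<xi> n\<bar>) (\<lambda>k. \<delta> * real (Suc k))"
  have "finite P"
    by (simp add: P_def)
  have sumJ: "(\<Sum>j\<in>J. f j) = (\<Sum>m\<le>N. \<Sum>n\<in>{..N}-{m}. f (Inl (m, n))) + (\<Sum>k<K. f (Inr k))"
    for f :: "_ \<Rightarrow> real"
  proof -
    have "(\<Sum>j\<in>J. f j) = (\<Sum>p\<in>P. f (Inl p)) + (\<Sum>k<K. f (Inr k))"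
      unfolding J_def using \<open>finite P\<close>
      by (subst sum.union_disjoint) (auto simp: sum.reindex)
    also have "(\<Sum>p\<in>P. f (Inl p)) = (\<Sum>m\<le>N. \<Sum>n\<in>{..N}-{m}. f (Inl (m, n)))"
      unfolding P_def by (subst sum.Sigma) auto
    finally show ?thesis .
  qed
  have d_pos: "d j > 0" if "j \<in> J" for j
  proof -
    have "0 < \<bar>\<xi> m - \<xi> n\<bar>" if "m \<le> N" "n \<le> N" "m \<noteq> n" for m n
      using sep that \<open>\<delta> > 0\<close> unfolding separated_def by fastforce
    with that \<open>\<delta> > 0\<close> show ?thesis
      by (fastforce simp: J_def P_def d_def)
  qed
  have A: "A \<ge> 0"
    by (simp add: A_def sum_nonneg)
  \<comment> \<open>The tail 2 A b q^K / (s \<delta>) has the form B exp (-s D) / s with B = 2 A b /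
    \<delta> and D = K \<delta>.\<close>
  have "0 \<le> (\<Sum>j\<in>J. c j * d j powr - \<sigma>) +
            (2 * A * b / \<delta>) * (real K * \<delta>) powr (1 - \<sigma>) / (\<sigma> - 1)"
  proof (rule Mellin_nonneg)
    fix s :: real assume "s > 0"
    define q where "q = exp (- s * \<delta>)"
    have q: "0 < q" "q < 1"
      using \<open>\<delta> > 0\<close> \<open>s > 0\<close> by (simp_all add: q_def)
    have geo: "(\<Sum>k<K. (- \<epsilon>) ^ k * q ^ Suc k) = q * (1 - (- \<epsilon> * q) ^ K) / (1 + \<epsilon> * q)"
    proof -
      have "(\<Sum>k<K. (- \<epsilon>) ^ k * q ^ Suc k) = q * (\<Sum>k<K. (- \<epsilon> * q) ^ k)"
        by (simp add: sum_distrib_left mult_ac flip: power_mult_distrib)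
      also have "\<dots> = q * ((1 - (- \<epsilon> * q) ^ K) / (1 + \<epsilon> * q))"
        using q \<epsilon> by (subst sum_gp_strict) auto
      finally show ?thesis by simp
    qed
    have tail: "q / (1 + \<epsilon> * q) \<le> (\<Sum>k<K. (- \<epsilon>) ^ k * q ^ Suc k) + b * q ^ K / (s * \<delta>)"
      using \<epsilon>
    proof
      \<comment> \<open>For odd K the numerator in \<open>geo\<close> is 1 + q^K, which is at least
        1.\<close>
      assume *: "\<epsilon> = 1 \<and> odd K \<and> b = 0"
      then have "(- \<epsilon> * q) ^ K = - (q ^ K)"
        by simp
      with q * show ?thesis
        unfolding geo by (simp add: divide_simps)
    next
      assume *: "\<epsilon> = - 1 \<and> \<sigma> > 1 \<and> b = 1"
      \<comment> \<open>The quotient q / (1 - q) is the reciprocal of exp (s \<delta>) - 1.\<close>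
      have "s * \<delta> \<le> exp (s * \<delta>) - 1"
        using exp_ge_add_one_self[of "s * \<delta>"] by linarith
      also have "\<dots> = (1 - q) / q"
        using q by (simp add: q_def exp_minus field_simps)
      finally have "q / (1 - q) \<le> 1 / (s * \<delta>)"
        using q \<open>s > 0\<close> \<open>\<delta> > 0\<close> by (simp add: field_simps)
      then have "q ^ K * (q / (1 - q)) \<le> q ^ K * (1 / (s * \<delta>))"
        using q by (intro mult_left_mono) auto
      with * show ?thesis
        unfolding geo by (simp add: right_diff_distrib diff_divide_distrib mult_ac)
    qed
    have "0 \<le> \<epsilon> * (\<Sum>m\<le>N. \<Sum>n\<in>{..N}-{m}. Re (a m * cnj (a n)) * exp (- s * \<bar>\<xi> m - \<xi> n\<bar>)) +
               2 * q / (1 + \<epsilon> * q) * A"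
      unfolding A_def q_def using \<epsilon> by (intro exp_form_bound sep \<open>\<delta> > 0\<close> \<open>s > 0\<close>) auto
    also have "2 * q / (1 + \<epsilon> * q) * A =  2 * A * (q / (1 + \<epsilon> * q))"
      by simp
    also have "\<dots> \<le> 2 * A * ((\<Sum>k<K. (- \<epsilon>) ^ k * q ^ Suc k) + b * q ^ K / (s * \<delta>))"
      using tail A by (intro mult_left_mono) auto
    also have "q ^ K = exp (- s * (real K * \<delta>))"
      by (simp add: q_def mult_ac flip: exp_of_nat_mult)
    also have "(\<lambda>k. (- \<epsilon>) ^ k * q ^ Suc k) = (\<lambda>k. (- \<epsilon>) ^ k * exp (- s * (\<delta> * real (Suc k))))"
      by (simp add: q_def mult_ac fun_eq_iff del: power_Suc of_nat_Suc flip: exp_of_nat_mult)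
    finally have "0 \<le> \<epsilon> * (\<Sum>m\<le>N. \<Sum>n\<in>{..N}-{m}. Re (a m * cnj (a n)) * exp (- s * \<bar>\<xi> m - \<xi> n\<bar>)) +
         2 * A * ((\<Sum>k<K. (- \<epsilon>) ^ k * exp (- s * (\<delta> * real (Suc k)))) +
         b * exp (- s * (real K * \<delta>)) / (s * \<delta>))"
      by simp
    also have "\<dots> = (\<Sum>j\<in>J. c j * exp (- s * d j)) +
        (2 * A * b / \<delta>) * exp (- s * (real K * \<delta>)) / s"
      unfolding sumJ c_def d_def
      by (simp add: distrib_left sum_distrib_left mult_ac del: of_nat_Suc)
    finally show "0 \<le> \<dots>" .
  qed (use assms \<open>finite P\<close> d_pos in \<open>auto simp: J_def\<close>)
  also have "(\<Sum>j\<in>J. c j * d j powr - \<sigma>) =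
      \<epsilon> * Re (hilbert_form \<sigma> N \<xi> a) + 2 * A * (\<Sum>k<K. (- \<epsilon>) ^ k * (\<delta> * real (Suc k)) powr - \<sigma>)"
    unfolding sumJ c_def d_def
    by (simp add: Re_hilbert_form sum_distrib_left mult_ac del: of_nat_Suc)
  also have "(\<Sum>k<K. (- \<epsilon>) ^ k * (\<delta> * real (Suc k)) powr - \<sigma>) =
      (\<Sum>k<K. (- \<epsilon>) ^ k * real (Suc k) powr - \<sigma>) / \<delta> powr \<sigma>"
    using \<open>\<delta> > 0\<close>
    by (simp add: sum_distrib_left powr_mult powr_minus divide_inverse mult_ac del: of_nat_Suc)
  also have "2 * A * b / \<delta> * (real K * \<delta>) powr (1 - \<sigma>) = 2 * A * b * real K powr (1 - \<sigma>) / \<delta> powr \<sigma>"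
    using \<open>\<delta> > 0\<close> by (simp add: powr_mult powr_diff)
  finally show ?thesis
    by (simp add: A_def distrib_left distrib_right mult_ac add_divide_distrib)
qed

section \<open>Sharpness\<close>

text \<open>A Cesaro argument: if c > L, choose d strictly between. Only finitely many terms reach
  d, so their total excess is bounded by \<open>B\<close>, while (c - d)(N + 1) is
  unbounded.\<close>

lemma le_limit_of_le_mean:
  fixes f :: "nat \<Rightarrow> real"
  assumes lim: "f \<longlonglongrightarrow> L" and le: "\<And>N. c * real (Suc N) \<le> (\<Sum>j\<le>N. f j)"
  shows "c \<le> L"
proof (rule ccontr)
  assume "\<not> c \<le> L"
  then obtain d where d: "L < d" "d < c"
    using dense[of L c] by auto
  from order_tendstoD(2)[OF lim d(1)] obtain J where J: "\<And>j. j \<ge> J \<Longrightarrow> f j < d"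
    by (auto simp: eventually_sequentially)
  define B where "B = (\<Sum>j<J. \<bar>f j - d\<bar>)"
  have "(c - d) * real (Suc N) \<le> B" for N
  proof -
    have "(c - d) * real (Suc N) \<le> (\<Sum>j\<le>N. f j - d)"
      using le[of N] by (simp add: sum_subtractf algebra_simps)
    also have "\<dots> \<le> (\<Sum>j\<le>N. if j < J then \<bar>f j - d\<bar> else 0)"
      using J by (intro sum_mono) (auto simp: not_less less_imp_le)
    also have "\<dots> = (\<Sum>j\<in>{j. j \<le> N \<and> j < J}. \<bar>f j - d\<bar>)"
      by (intro sum.mono_neutral_cong_right) auto
    also have "\<dots> \<le> B"
      unfolding B_def by (intro sum_mono2) auto
    finally show ?thesis .
  qed
  moreover obtain N where "B / (c - d) < real N"
    using reals_Archimedean2 by blast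
  then have "B < (c - d) * real (Suc N)"
    using d by (simp add: field_simps)
  ultimately show False
    by (meson not_less)
qed

text \<open>Row j restricted to smaller indices is a partial sum of the series, since its distances
  are \<delta>, 2 \<delta>, ..., j \<delta>; symmetry doubles it. After division by N + 1 the form
  is a Cesaro mean.\<close>

lemma hilbert_form_arithmetic_progression:
  assumes "\<delta> > 0" and e: "e = 1 \<or> e = (-1::real)"
  shows "Re (hilbert_form \<sigma> N (\<lambda>n. \<delta> * real n) (\<lambda>n. of_real (e ^ n))) =
           2 / \<delta> powr \<sigma> * (\<Sum>j\<le>N. \<Sum>k<j. e ^ Suc k * real (Suc k) powr - \<sigma>)"
proof -
  define g where "g = (\<lambda>m n. e ^ m * e ^ n * \<bar>\<delta> * real m - \<delta> * real n\<bar> powr - \<sigma>)"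
  have g_sym: "g m n = g n m" for m n
    by (simp add: g_def abs_minus_commute)
  have row: "(\<Sum>n<M. g M n) = (\<Sum>k<M. e ^ Suc k * real (Suc k) powr - \<sigma>) / \<delta> powr \<sigma>" for M
  proof -
    have "(\<Sum>n<M. g M n) = (\<Sum>k<M. g M (M - Suc k))"
      by (rule sum.nat_diff_reindex[symmetric])
    also have "\<dots> = (\<Sum>k<M. e ^ Suc k * real (Suc k) powr - \<sigma> / \<delta> powr \<sigma>)"
    proof (rule sum.cong)
      fix k assume "k \<in> {..<M}"
      then obtain i where M: "M = i + Suc k"
        by (metis add.commute le_add_diff_inverse2 lessThan_iff Suc_leI)
      have "\<bar>\<delta> * real M - \<delta> * real i\<bar> = \<delta> * real (Suc k)"
        using \<open>\<delta> > 0\<close> by (simp add: M algebra_simps)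
      \<comment> \<open>The exponent M + i is 2 i + Suc k, and e^2 = 1.\<close>
      moreover have "e ^ M * e ^ i = e ^ Suc k"
        using e by (auto simp: M power_add)
      ultimately show "g M (M - Suc k) = e ^ Suc k * real (Suc k) powr - \<sigma> / \<delta> powr \<sigma>"
        using \<open>\<delta> > 0\<close> by (simp add: g_def M powr_mult powr_minus divide_inverse del: of_nat_Suc power_Suc)
    qed simp
    finally show ?thesis
      by (simp add: sum_divide_distrib)
  qed
  have "(\<Sum>m\<le>N. \<Sum>n\<in>{..N}-{m}. g m n) = (\<Sum>j\<le>N. 2 * (\<Sum>n<j. g j n))"
  \<comment> \<open>Passing to \<open>Suc N\<close> adds one row and one column, which agree by
    \<open>g_sym\<close>.\<close>
  proof (induction N)
    case (Suc N)
    have "(\<Sum>m\<le>Suc N. \<Sum>n\<in>{..Suc N}-{m}. g m n) =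
          (\<Sum>m\<le>N. \<Sum>n\<in>{..Suc N}-{m}. g m n) + (\<Sum>n\<in>{..Suc N}-{Suc N}. g (Suc N) n)"
      by simp
    also have "{..Suc N} - {Suc N} = {..N}"
      by auto
    also have "(\<Sum>m\<le>N. \<Sum>n\<in>{..Suc N}-{m}. g m n) = (\<Sum>m\<le>N. g (Suc N) m + (\<Sum>n\<in>{..N}-{m}. g m n))"
    proof (rule sum.cong)
      fix m assume "m \<in> {..N}"
      then have "{..Suc N} - {m} = insert (Suc N) ({..N} - {m})"
        by auto
      then show "(\<Sum>n\<in>{..Suc N}-{m}. g m n) = g (Suc N) m + (\<Sum>n\<in>{..N}-{m}. g m n)"
        by (simp add: g_sym)
    qed simp
    finally show ?case
      using Suc.IH by (simp add: sum.distrib lessThan_Suc_atMost)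
  qed simp
  moreover have "Re (hilbert_form \<sigma> N (\<lambda>n. \<delta> * real n) (\<lambda>n. of_real (e ^ n))) =
      (\<Sum>m\<le>N. \<Sum>n\<in>{..N}-{m}. g m n)"
    unfolding Re_hilbert_form g_def by (intro sum.cong refl) (simp flip: of_real_power)
  ultimately show ?thesis
    by (simp add: row sum_distrib_left sum_divide_distrib)
qed

text \<open>The sign \<epsilon> = 1 yields the lower bound and \<epsilon> = -1 the upper one.
  Letting K tend to infinity in \<open>hilbert_form_bound\<close> turns the partial sums into L; the
  correction term is either absent or decays because \<sigma> > 1.\<close>

lemma hilbert_form_signed_bound:
  assumes "\<delta> > 0" "\<sigma> > 0" and \<epsilon>: "\<epsilon> = 1 \<or> \<epsilon> = (-1::real) \<and> \<sigma> > 1"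
    and sums: "(\<lambda>k. (- \<epsilon>) ^ k * real (Suc k) powr - \<sigma>) sums L"
    and sep: "separated \<delta> N \<xi>"
  shows "- (2 * L / \<delta> powr \<sigma>) * (\<Sum>n\<le>N. (cmod (a n))\<^sup>2) \<le> \<epsilon> * Re (hilbert_form \<sigma> N \<xi> a)"
proof -
  define A where "A = (\<Sum>n\<le>N. (cmod (a n))\<^sup>2)"
  define b :: real where "b = (if \<epsilon> = 1 then 0 else 1)"
  define S where "S = (\<lambda>K. (\<Sum>k<K. (- \<epsilon>) ^ k * real (Suc k) powr - \<sigma>) +
    b * real K powr (1 - \<sigma>) / (\<sigma> - 1))"
  have "(\<lambda>K. b * real K powr (1 - \<sigma>) / (\<sigma> - 1)) \<longlonglongrightarrow> 0"
  proof (cases "\<epsilon> = 1")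
    case False
    with \<epsilon> have "(\<lambda>K. real K powr (1 - \<sigma>)) \<longlonglongrightarrow> 0"
      by (intro tendsto_neg_powr filterlim_real_sequentially) auto
    then show ?thesis
      by (intro tendsto_divide_zero tendsto_mult_right_zero)
  qed (simp add: b_def)
  with sums have "S \<longlonglongrightarrow> L + 0"
    unfolding S_def sums_def by (rule tendsto_add)
  \<comment> \<open>\<open>hilbert_form_bound\<close> admits only odd K when \<epsilon> = 1, so the
    limit is taken along K = 2 k + 1 for both signs.\<close>
  moreover have "filterlim (\<lambda>k. 2 * k + 1) at_top (sequentially :: nat filter)"
    by (rule filterlim_subseq) (simp add: strict_mono_def)
  ultimately have "(\<lambda>k. S (2 * k + 1)) \<longlonglongrightarrow> L"
    by (auto intro: filterlim_compose)
  then have "(\<lambda>k. \<epsilon> * Re (hilbert_form \<sigma> N \<xi> a) + 2 / \<delta> powr \<sigma> * S (2 * k + 1) * A) \<longlonglongrightarrow>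
             \<epsilon> * Re (hilbert_form \<sigma> N \<xi> a) + 2 / \<delta> powr \<sigma> * L * A"
    by (intro tendsto_intros)
  moreover have "0 \<le> \<epsilon> * Re (hilbert_form \<sigma> N \<xi> a) + 2 / \<delta> powr \<sigma> * S (2 * k + 1) * A" for k
    unfolding S_def A_def using \<epsilon> by (intro hilbert_form_bound assms) (auto simp: b_def)
  ultimately have "0 \<le> \<epsilon> * Re (hilbert_form \<sigma> N \<xi> a) + 2 / \<delta> powr \<sigma> * L * A"
    by (intro LIMSEQ_le_const) auto
  then show ?thesis
    by (simp add: A_def)
qed

text \<open>The coefficients (-\<epsilon>)^n have modulus 1, so the sum of squares is N + 1 and the
  assumed bound becomes one for Cesaro means of the partial sums, hence for their limit.\<close>

lemma hilbert_form_signed_sharp: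
  assumes "\<delta> > 0" and \<epsilon>: "\<epsilon> = 1 \<or> \<epsilon> = (-1::real)"
    and sums: "(\<lambda>k. (- \<epsilon>) ^ k * real (Suc k) powr - \<sigma>) sums L"
    and bound: "\<And>N \<xi> a. separated \<delta> N \<xi> \<Longrightarrow>
                  - C * (\<Sum>n\<le>N. (cmod (a n))\<^sup>2) \<le> \<epsilon> * Re (hilbert_form \<sigma> N \<xi> a)"
  shows "2 * L / \<delta> powr \<sigma> \<le> C"
proof -
  define f where "f = (\<lambda>j. - (2 / \<delta> powr \<sigma> * (\<Sum>k<j. (- \<epsilon>) ^ k * real (Suc k) powr - \<sigma>)))"
  have "f \<longlonglongrightarrow> - (2 / \<delta> powr \<sigma> * L)"
    unfolding f_def using sums[unfolded sums_def] by (intro tendsto_intros)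
  moreover have "- C * real (Suc N) \<le> (\<Sum>j\<le>N. f j)" for N
  proof -
    have "separated \<delta> N (\<lambda>n. \<delta> * real n)"
      unfolding separated_def
    proof (intro allI impI)
      fix m n :: nat assume "m \<noteq> n"
      then have "1 \<le> \<bar>real m - real n\<bar>"
        by linarith
      then have "\<delta> * 1 \<le> \<delta> * \<bar>real m - real n\<bar>"
        using \<open>\<delta> > 0\<close> by (intro mult_left_mono) auto
      also have "\<dots> = \<bar>\<delta> * real m - \<delta> * real n\<bar>"
        using \<open>\<delta> > 0\<close> by (simp add: abs_mult flip: right_diff_distrib)
      finally show "\<delta> \<le> \<bar>\<delta> * real m - \<delta> * real n\<bar>"
        by simp
    qed
    from bound[OF this, of "\<lambda>n. of_real ((- \<epsilon>) ^ n)"]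
    have "- C * real (Suc N) \<le>
        \<epsilon> * Re (hilbert_form \<sigma> N (\<lambda>n. \<delta> * real n) (\<lambda>n. of_real ((- \<epsilon>) ^ n)))"
      using \<epsilon> by (auto simp: norm_power)
    also have "\<dots> = \<epsilon> * (2 / \<delta> powr \<sigma> * (\<Sum>j\<le>N. \<Sum>k<j. (- \<epsilon>) ^ Suc k * real (Suc k) powr - \<sigma>))"
      using \<epsilon> by (subst hilbert_form_arithmetic_progression[OF \<open>\<delta> > 0\<close>]) auto
    \<comment> \<open>Here \<epsilon> (-\<epsilon>)^(k+1) = -(-\<epsilon>)^k.\<close>
    also have "\<dots> = (\<Sum>j\<le>N. f j)"
      using \<epsilon> by (auto simp: f_def sum_distrib_left sum_negf)
    finally show ?thesis .
  qed
  ultimately have "- C \<le> - (2 / \<delta> powr \<sigma> * L)"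
    by (rule le_limit_of_le_mean)
  then show ?thesis
    by simp
qed

section \<open>Sharp constants as values of series\<close>

lemma sharp_hilbert_lower_bound:
  assumes "\<delta> > 0" "\<sigma> > 0" "L > 0"
    and sums: "(\<lambda>k. (-1) ^ k * real (Suc k) powr - \<sigma>) sums L"
  shows "sharp_constant (hilbert_lower_bound \<sigma> \<delta>) (2 * L / \<delta> powr \<sigma>)"
proof -
  \<comment> \<open>Both imaginary parts are 0, so only real parts matter; the factor 1 is the sign
    \<epsilon> of the signed lemmas.\<close>
  have iff: "hilbert_lower_bound \<sigma> \<delta> C \<longleftrightarrow> (\<forall>N \<xi> a. separated \<delta> N \<xi> \<longrightarrow>
      - C * (\<Sum>n\<le>N. (cmod (a n))\<^sup>2) \<le> 1 * Re (hilbert_form \<sigma> N \<xi> a))" for C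
    unfolding hilbert_lower_bound_def less_eq_complex_def
    by (simp only: Im_hilbert_form Im_complex_of_real Re_complex_of_real) simp
  show ?thesis
    unfolding sharp_constant_def iff
  proof (intro conjI allI impI)
    show "2 * L / \<delta> powr \<sigma> > 0"
      using assms by simp
    show "- (2 * L / \<delta> powr \<sigma>) * (\<Sum>n\<le>N. (cmod (a n))\<^sup>2) \<le> 1 * Re (hilbert_form \<sigma> N \<xi> a)"
      if "separated \<delta> N \<xi>" for N \<xi> a
      using assms that by (intro hilbert_form_signed_bound) auto
    show "\<not> (\<forall>N \<xi> a. separated \<delta> N \<xi> \<longrightarrow>
        - C * (\<Sum>n\<le>N. (cmod (a n))\<^sup>2) \<le> 1 * Re (hilbert_form \<sigma> N \<xi> a))"
      if "C < 2 * L / \<delta> powr \<sigma>" for C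
      using that assms hilbert_form_signed_sharp[of \<delta> 1 \<sigma> L C] by fastforce
  qed
qed

lemma sharp_hilbert_upper_bound:
  assumes "\<delta> > 0" "\<sigma> > 1" "L > 0"
    and sums: "(\<lambda>k. real (Suc k) powr - \<sigma>) sums L"
  shows "sharp_constant (hilbert_upper_bound \<sigma> \<delta>) (2 * L / \<delta> powr \<sigma>)"
proof -
  \<comment> \<open>Negating both sides gives the signed bound with \<epsilon> = -1.\<close>
  have iff: "hilbert_upper_bound \<sigma> \<delta> C \<longleftrightarrow> (\<forall>N \<xi> a. separated \<delta> N \<xi> \<longrightarrow>
      - C * (\<Sum>n\<le>N. (cmod (a n))\<^sup>2) \<le> - 1 * Re (hilbert_form \<sigma> N \<xi> a))" for C
    unfolding hilbert_upper_bound_def less_eq_complex_def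
    by (simp only: Im_hilbert_form Im_complex_of_real Re_complex_of_real) simp
  show ?thesis
    unfolding sharp_constant_def iff
  proof (intro conjI allI impI)
    show "2 * L / \<delta> powr \<sigma> > 0"
      using assms by simp
    show "- (2 * L / \<delta> powr \<sigma>) * (\<Sum>n\<le>N. (cmod (a n))\<^sup>2) \<le> - 1 * Re (hilbert_form \<sigma> N \<xi> a)"
      if "separated \<delta> N \<xi>" for N \<xi> a
      using assms that by (intro hilbert_form_signed_bound) auto
    show "\<not> (\<forall>N \<xi> a. separated \<delta> N \<xi> \<longrightarrow>
        - C * (\<Sum>n\<le>N. (cmod (a n))\<^sup>2) \<le> - 1 * Re (hilbert_form \<sigma> N \<xi> a))"
      if "C < 2 * L / \<delta> powr \<sigma>" for C
      using that assms hilbert_form_signed_sharp[of \<delta> "-1" \<sigma> L C] by fastforce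
  qed
qed

section \<open>Analytic continuation of the zeta-function\<close>

text \<open>Taylor remainder of \<open>x powr (1 - s)\<close> between \<open>n + 1\<close> and \<open>n + 2\<close>. Its sum over \<open>n\<close> converges
  for \<open>Re s > 1 - K\<close>, and for \<open>Re s > 1\<close> the main terms telescope or are multiples of zeta at
  \<open>s, s + 1, \<dots>\<close>; this continues \<open>(s - 1) \<zeta>(s)\<close> one half-plane at a time.\<close>

definition zeta_remainder :: "nat \<Rightarrow> nat \<Rightarrow> complex \<Rightarrow> complex" where
  "zeta_remainder K n s = of_nat (n + 2) powr (1 - s) -
     (\<Sum>j\<le>K. ((1 - s) gchoose j) * of_nat (n + 1) powr (1 - s - of_nat j))"

text \<open>Taylor's theorem on the real segment from n + 1 to n + 2. The factor
  \<open>Suc K\<close> is \<open>fact (Suc K) / fact K\<close>.\<close>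

lemma norm_zeta_remainder_le:
  assumes "Re s + real K \<ge> 0"
  shows "cmod (zeta_remainder K n s) \<le>
           real (Suc K) * cmod ((1 - s) gchoose Suc K) * real (n + 1) powr (- Re s - real K)"
proof -
  define a where "a = 1 - s"
  define S where "S = closed_segment (of_nat (n + 1)) (of_nat (n + 2) :: complex)"
  define f where "f = (\<lambda>j z. (a gchoose j) * fact j * z powr (a - of_nat j))"
  define B where "B = cmod (a gchoose Suc K) * fact (Suc K) * real (n + 1) powr (- Re s - real K)"
  have S: "z \<in> \<real>" "Re z \<ge> real (n + 1)" if "z \<in> S" for z
  proof -
    have "z \<in> of_real ` closed_segment (real (n + 1)) (real (n + 2))"
      using that closed_segment_of_real[of "real (n + 1)" "real (n + 2)", where 'a = complex]
      by (simp add: S_def)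
    then show "z \<in> \<real>" "Re z \<ge> real (n + 1)"
      by (auto simp: closed_segment_eq_real_ivl)
  qed
  have "cmod (f 0 (of_nat (n + 2)) - (\<Sum>j\<le>K. f j (of_nat (n + 1)) *
          (of_nat (n + 2) - of_nat (n + 1)) ^ j / fact j)) \<le>
        B * cmod (of_nat (n + 2) - of_nat (n + 1)) ^ Suc K / fact K"
  proof (rule field_Taylor[where S = S])
    show "convex S"
      by (simp add: S_def)
    show "(f j has_field_derivative f (Suc j) z) (at z within S)" if "z \<in> S" for j z
    proof -
      have "z \<notin> \<real>\<^sub>\<le>\<^sub>0"
        using S[OF that] by (auto simp: complex_nonpos_Reals_iff)
      then have "(f j has_field_derivative
          (a gchoose j) * fact j * ((a - of_nat j) * z powr (a - of_nat j - 1))) (at z within S)"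
        unfolding f_def by (intro DERIV_cmult has_field_derivative_at_within[OF has_field_derivative_powr])
      also have "(a gchoose j) * fact j * ((a - of_nat j) * z powr (a - of_nat j - 1)) = f (Suc j) z"
      proof -
        have "(a gchoose Suc j) * fact (Suc j) = (a gchoose j) * fact j * (a - of_nat j)"
          by (simp only: gbinomial_mult_fact' prod.atLeast0_lessThan_Suc)
        then show ?thesis
          by (simp add: f_def diff_diff_eq add.commute del: fact_Suc)
      qed
      finally show ?thesis .
    qed
    show "cmod (f (Suc K) z) \<le> B" if "z \<in> S" for z
    proof -
      have "cmod (z powr (a - of_nat (Suc K))) = Re z powr (- Re s - real K)"
        using S[OF that] by (simp add: norm_powr_real_powr a_def)
      also have "\<dots> \<le> real (n + 1) powr (- Re s - real K)"
        using S[OF that] assms by (intro powr_mono2') auto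
      finally show ?thesis
        unfolding f_def B_def norm_mult norm_fact by (intro mult_left_mono) auto
    qed
  qed (auto simp: S_def)
  moreover have "cmod (f 0 (of_nat (n + 2)) - (\<Sum>j\<le>K. f j (of_nat (n + 1)) *
          (of_nat (n + 2) - of_nat (n + 1)) ^ j / fact j)) = cmod (zeta_remainder K n s)"
    by (simp add: f_def zeta_remainder_def a_def)
  ultimately show ?thesis
    by (simp add: B_def a_def mult_ac)
qed

lemma holomorphic_on_gbinomial [holomorphic_intros]:
  "f holomorphic_on A \<Longrightarrow> (\<lambda>s. f s gchoose k) holomorphic_on A"
  unfolding gbinomial_prod_rev by (intro holomorphic_intros) auto

lemma holomorphic_zeta_remainder: "zeta_remainder K n holomorphic_on A"
  unfolding zeta_remainder_def by (intro holomorphic_intros)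

lemma summable_norm_zeta_remainder:
  assumes "Re s > 1 - real K"
  shows "summable (\<lambda>n. cmod (zeta_remainder K n s))"
proof (rule summable_comparison_test')
  have "summable (\<lambda>n. real (n + 1) powr (- Re s - real K))"
    using assms summable_real_powr_iff[of "- Re s - real K"]
      summable_iff_shift[of "\<lambda>n. real n powr (- Re s - real K)" 1] by simp
  then show "summable (\<lambda>n. real (Suc K) * cmod ((1 - s) gchoose Suc K) *
      real (n + 1) powr (- Re s - real K))"
    by (rule summable_mult)
  show "norm (cmod (zeta_remainder K n s)) \<le> real (Suc K) * cmod ((1 - s) gchoose Suc K) *
      real (n + 1) powr (- Re s - real K)" for n
    using norm_zeta_remainder_le[of s K n] assms by simp
qed

definition zeta_remainder_sum :: "nat \<Rightarrow> complex \<Rightarrow> complex" where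
  "zeta_remainder_sum K s = (\<Sum>n. zeta_remainder K n s)"

text \<open>The Weierstrass M-test on closed discs gives locally uniform convergence.\<close>

lemma holomorphic_zeta_remainder_sum:
  "zeta_remainder_sum K holomorphic_on {s. Re s > 1 - real K}"
proof (rule holomorphic_uniform_sequence)
  show "open {s. Re s > 1 - real K}"
    by (rule open_halfspace_Re_gt)
  show "(\<lambda>s. \<Sum>n<N. zeta_remainder K n s) holomorphic_on {s. Re s > 1 - real K}" for N
    by (intro holomorphic_intros holomorphic_zeta_remainder)
next
  fix z assume z: "z \<in> {s. Re s > 1 - real K}"
  define d where "d = (Re z + real K - 1) / 2"
  have d: "d > 0"
    using z by (simp add: d_def)
  have Re: "Re s + real K \<ge> 1 + d" if "s \<in> cball z d" for s
    using that abs_Re_le_cmod[of "z - s"] by (simp add: dist_norm d_def field_simps abs_le_iff)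
  have "compact ((\<lambda>s. (1 - s) gchoose Suc K) ` cball z d)"
    by (intro compact_continuous_image holomorphic_on_imp_continuous_on holomorphic_intros compact_cball)
  then obtain M where M: "cmod ((1 - s) gchoose Suc K) \<le> M" if "s \<in> cball z d" for s
    by (meson compact_imp_bounded bounded_iff imageI)
  have "uniform_limit (cball z d) (\<lambda>N s. \<Sum>n<N. zeta_remainder K n s)
          (\<lambda>s. \<Sum>n. zeta_remainder K n s) sequentially"
  proof (rule Weierstrass_m_test)
    have "summable (\<lambda>n. real (n + 1) powr - (1 + d))"
      using d summable_real_powr_iff[of "- (1 + d)"]
        summable_iff_shift[of "\<lambda>n. real n powr - (1 + d)" 1] by simp
    then show "summable (\<lambda>n. real (Suc K) * M * real (n + 1) powr - (1 + d))"
      by (rule summable_mult)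
    fix n s assume s: "s \<in> cball z d"
    have "0 \<le> M"
      using M[OF s] norm_ge_zero by (rule order_trans[rotated])
    have "cmod (zeta_remainder K n s) \<le>
        real (Suc K) * cmod ((1 - s) gchoose Suc K) * real (n + 1) powr (- Re s - real K)"
      using Re[OF s] d by (intro norm_zeta_remainder_le) auto
    also have "\<dots> \<le> real (Suc K) * M * real (n + 1) powr - (1 + d)"
      using Re[OF s] d M[OF s] \<open>0 \<le> M\<close> by (intro mult_mono mult_left_mono powr_mono) auto
    finally show "cmod (zeta_remainder K n s) \<le> real (Suc K) * M * real (n + 1) powr - (1 + d)" .
  qed
  moreover have "cball z d \<subseteq> {s. Re s > 1 - real K}"
    using Re d by fastforce
  ultimately show "\<exists>d>0. cball z d \<subseteq> {s. Re s > 1 - real K} \<and>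
      uniform_limit (cball z d) (\<lambda>N s. \<Sum>n<N. zeta_remainder K n s) (zeta_remainder_sum K) sequentially"
    using d by (auto simp: zeta_remainder_sum_def[abs_def])
qed

section \<open>Recursion from one half-plane to the next\<close>

definition dirichlet_zeta :: "complex \<Rightarrow> complex" where
  "dirichlet_zeta s = (\<Sum>n. 1 / of_nat (Suc n) powr s)"

lemma dirichlet_zeta_sums:
  assumes "Re s > 1"
  shows "(\<lambda>n. 1 / of_nat (Suc n) powr s) sums dirichlet_zeta s"
proof -
  have "summable (\<lambda>n. real (n + 1) powr - Re s)"
    using assms summable_real_powr_iff[of "- Re s"]
      summable_iff_shift[of "\<lambda>n. real n powr - Re s" 1] by simp
  then have "summable (\<lambda>n. cmod (1 / of_nat (Suc n) powr s))"
    by (simp add: norm_divide norm_powr_real_powr powr_minus_divide)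
  then show ?thesis
    unfolding dirichlet_zeta_def by (intro summable_sums) (rule summable_norm_cancel)
qed

lemma zeta_remainder_eq:
  "zeta_remainder K n s = (of_nat (n + 2) powr (1 - s) - of_nat (n + 1) powr (1 - s)) -
     (\<Sum>i<K. ((1 - s) gchoose Suc i) * (1 / of_nat (Suc n) powr (s + of_nat i)))"
proof -
  have *: "of_nat (n + 1) powr (1 - s - of_nat (Suc i)) = 1 / of_nat (Suc n) powr (s + of_nat i)"
    for i :: nat
    by (simp add: powr_minus_divide[symmetric] algebra_simps)
  show ?thesis
    unfolding zeta_remainder_def sum.atMost_shift * by simp
qed

text \<open>Summing \<open>zeta_remainder_eq\<close> over n, the differences telescope to -1 and
  each binomial term becomes a zeta value at s + i.\<close>

lemma zeta_remainder_sum_eq: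
  assumes "Re s > 1" "K > 0"
  shows "(s - 1) * dirichlet_zeta s = 1 + zeta_remainder_sum K s -
    (\<Sum>i\<in>{1..<K}. ((1 - s) gchoose i) / of_nat (Suc i) * ((s + of_nat i - 1) * dirichlet_zeta (s + of_nat i)))"
proof -
  have "(\<lambda>n. real (n + 1) powr (1 - Re s)) \<longlonglongrightarrow> 0"
    using assms by real_asymp
  then have "(\<lambda>n. cmod (of_nat (n + 1) powr (1 - s))) \<longlonglongrightarrow> 0"
    by (simp add: norm_powr_real_powr)
  then have "(\<lambda>n. of_nat (n + 1) powr (1 - s)) \<longlonglongrightarrow> (0::complex)"
    by (rule tendsto_norm_zero_cancel)
  from telescope_sums[OF this]
  have "(\<lambda>n. of_nat (n + 2) powr (1 - s) - of_nat (n + 1) powr (1 - s)) sums (- 1 :: complex)"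
    by simp
  moreover have "(\<lambda>n. \<Sum>i<K. ((1 - s) gchoose Suc i) * (1 / of_nat (Suc n) powr (s + of_nat i))) sums
      (\<Sum>i<K. ((1 - s) gchoose Suc i) * dirichlet_zeta (s + of_nat i))"
    using assms by (intro sums_sum sums_mult dirichlet_zeta_sums) auto
  ultimately have "(\<lambda>n. zeta_remainder K n s) sums
      (- 1 - (\<Sum>i<K. ((1 - s) gchoose Suc i) * dirichlet_zeta (s + of_nat i)))"
    unfolding zeta_remainder_eq by (rule sums_diff)
  then have "zeta_remainder_sum K s =
      - 1 - (\<Sum>i<K. ((1 - s) gchoose Suc i) * dirichlet_zeta (s + of_nat i))"
    by (simp add: zeta_remainder_sum_def sums_iff)
  also have "(\<Sum>i<K. ((1 - s) gchoose Suc i) * dirichlet_zeta (s + of_nat i)) =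
      - (\<Sum>i<K. ((1 - s) gchoose i) / of_nat (Suc i) * ((s + of_nat i - 1) * dirichlet_zeta (s + of_nat i)))"
    unfolding sum_negf[symmetric]
  proof (rule sum.cong)
    have assoc: "- x * c / n * y = - (c / n * (x * y))" for x c n y :: complex
      by (simp add: divide_inverse mult_ac)
    fix i
    \<comment> \<open>Absorption produces the factor -(s + i - 1), which cancels the pole of zeta at
      s + i = 1.\<close>
    have "of_nat (Suc i) * ((1 - s) gchoose Suc i) = (1 - s - of_nat i) * ((1 - s) gchoose i)"
      by (simp only: gbinomial_absorption gbinomial_absorb_comp)
    then have *: "(1 - s) gchoose Suc i = - (s + of_nat i - 1) * ((1 - s) gchoose i) / of_nat (Suc i)"
      by (simp add: nonzero_eq_divide_eq mult.commute algebra_simps del: of_nat_Suc)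
    show "((1 - s) gchoose Suc i) * dirichlet_zeta (s + of_nat i) =
       - (((1 - s) gchoose i) / of_nat (Suc i) * ((s + of_nat i - 1) * dirichlet_zeta (s + of_nat i)))"
      unfolding * by (rule assoc)
  qed simp
  \<comment> \<open>The term i = 0 is exactly (s - 1) zeta(s), the quantity to be solved
    for.\<close>
  also have "{..<K} = insert 0 {1..<K}"
    using \<open>K > 0\<close> by auto
  finally show ?thesis
    by (simp add: algebra_simps)
qed

text \<open>In \<open>zeta_remainder_sum_eq\<close> the summands with i \<ge> 1 use the function
  only at s + i, inside the half-plane already reached, while the remainder series converges one
  unit further left.\<close>

lemma zeta_continuation_halfplane:
  assumes "K > 0"
  shows "\<exists>f. f holomorphic_on {s. Re s > 1 - real K} \<and>
             (\<forall>s. Re s > 1 \<longrightarrow> f s = (s - 1) * dirichlet_zeta s)"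
  using assms
proof (induction K)
  case (Suc K)
  show ?case
  proof (cases "K = 0")
    case True
    then show ?thesis
      using holomorphic_zeta_remainder_sum[of 1] zeta_remainder_sum_eq[of _ 1]
      by (intro exI[of _ "\<lambda>s. 1 + zeta_remainder_sum 1 s"]) (auto intro!: holomorphic_intros)
  next
    case False
    with Suc.IH obtain f where f: "f holomorphic_on {s. Re s > 1 - real K}"
        "\<And>s. Re s > 1 \<Longrightarrow> f s = (s - 1) * dirichlet_zeta s"
      by auto
    define g where "g = (\<lambda>s. 1 + zeta_remainder_sum (Suc K) s -
      (\<Sum>i\<in>{1..<Suc K}. ((1 - s) gchoose i) / of_nat (Suc i) * f (s + of_nat i)))"
    have "(f \<circ> (\<lambda>s. s + of_nat i)) holomorphic_on {s. Re s > 1 - real (Suc K)}" if "i \<ge> 1" for i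
      by (rule holomorphic_on_compose_gen[OF _ f(1)]) (use that in \<open>auto intro!: holomorphic_intros\<close>)
    then have "g holomorphic_on {s. Re s > 1 - real (Suc K)}"
      unfolding g_def
      by (intro holomorphic_intros holomorphic_zeta_remainder_sum) (auto simp: o_def)
    moreover have "g s = (s - 1) * dirichlet_zeta s" if "Re s > 1" for s
      unfolding g_def using that zeta_remainder_sum_eq[of s "Suc K"] f(2) by (simp del: of_nat_Suc)
    ultimately show ?thesis
      by blast
  qed
qed simp

text \<open>By the identity theorem the continuations agree on the smaller of any two half-planes,
  so they glue to an entire function.\<close>

lemma zeta_continuation:
  "\<exists>f. f holomorphic_on UNIV \<and> (\<forall>s. Re s > 1 \<longrightarrow> f s = (s - 1) * dirichlet_zeta s)"
proof -
  let ?H = "\<lambda>K. {s. Re s > 1 - real K}"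
  have "\<forall>K\<in>{0<..}. \<exists>f. f holomorphic_on ?H K \<and> (\<forall>s. Re s > 1 \<longrightarrow> f s = (s - 1) * dirichlet_zeta s)"
    using zeta_continuation_halfplane by auto
  then obtain F where F: "\<And>K. K > 0 \<Longrightarrow> F K holomorphic_on ?H K"
      "\<And>K s. K > 0 \<Longrightarrow> Re s > 1 \<Longrightarrow> F K s = (s - 1) * dirichlet_zeta s"
    by (auto simp: bchoice_iff)
  have agree: "F K s = F K' s" if "0 < K" "K \<le> K'" "s \<in> ?H K" for K K' s
  proof (rule analytic_continuation_open[of "{s. Re s > 1}" "?H K" "F K" "F K'"])
    show "{s. Re s > 1} \<noteq> {}"
      by (auto intro: exI[of _ 2])
    show "connected (?H K)"
      by (intro convex_connected convex_halfspace_Re_gt)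
    show "F K holomorphic_on ?H K"
      using that F(1) by auto
    have "?H K \<subseteq> ?H K'"
      using that by auto
    with that show "F K' holomorphic_on ?H K"
      using F(1)[of K'] by (auto elim: holomorphic_on_subset)
  qed (use that F(2) in \<open>auto intro: open_halfspace_Re_gt\<close>)
  define k where "k = (\<lambda>s. Suc (nat \<lceil>1 - Re s\<rceil>))"
  have k: "s \<in> ?H (k s)" for s
    unfolding k_def by simp linarith
  define f where "f = (\<lambda>s. F (k s) s)"
  have f: "f s = F K s" if "K > 0" "s \<in> ?H K" for s K
  proof -
    have "k s > 0"
      by (simp add: k_def)
    with that k show ?thesis
      unfolding f_def using agree[of "k s" K s] agree[of K "k s" s, symmetric] by (meson nat_le_linear)
  qed
  have "f holomorphic_on (\<Union>K\<in>{0<..}. ?H K)"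
  proof (rule holomorphic_on_UN_open)
    show "f holomorphic_on ?H K" if "K \<in> {0<..}" for K
    proof (rule holomorphic_transform[OF F(1)])
      show "F K s = f s" if "s \<in> ?H K" for s
        using f[OF _ that] \<open>K \<in> {0<..}\<close> by simp
    qed (use that in simp)
  qed (auto intro: open_halfspace_Re_gt)
  also have "(\<Union>K\<in>{0<..}. ?H K) = UNIV"
  proof -
    have "s \<in> (\<Union>K\<in>{0<..}. ?H K)" for s
      using k[of s] by (intro UN_I[of "k s"]) (simp_all add: k_def)
    then show ?thesis
      by blast
  qed
  finally show ?thesis
    using F(2) f[of 1] by (intro exI[of _ f]) simp
qed

text \<open>Dividing the entire function by s - 1 gives a witness for the choice in
  \<open>riemann_zeta_def\<close>.\<close>

lemma riemann_zeta_holomorphic: "riemann_zeta holomorphic_on - {1}"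
  and riemann_zeta_sums: "\<And>s. Re s > 1 \<Longrightarrow> (\<lambda>n. 1 / of_nat (Suc n) powr s) sums riemann_zeta s"
proof -
  obtain f where f: "f holomorphic_on UNIV" "\<And>s. Re s > 1 \<Longrightarrow> f s = (s - 1) * dirichlet_zeta s"
    using zeta_continuation by blast
  have "f s / (s - 1) = dirichlet_zeta s" if "Re s > 1" for s
    using f(2)[OF that] that by auto
  then have ex: "\<exists>f. f holomorphic_on - {1} \<and>
      (\<forall>s. Re s > 1 \<longrightarrow> (\<lambda>n. 1 / of_nat (Suc n) powr s) sums f s)"
    using dirichlet_zeta_sums f(1)
    by (intro exI[of _ "\<lambda>s. f s / (s - 1)"]) (auto intro!: holomorphic_intros intro: holomorphic_on_subset)
  from someI_ex[OF ex]
  show "riemann_zeta holomorphic_on - {1}"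
    unfolding riemann_zeta_def by auto
  from someI_ex[OF ex]
  show "(\<lambda>n. 1 / of_nat (Suc n) powr s) sums riemann_zeta s" if "Re s > 1" for s
    using that unfolding riemann_zeta_def by auto
qed

text \<open>Both sides agree for Re s > 1, and the half-plane without 1 is still connected. This
  makes zeta accessible for 0 < Re s \<le> 1 through a convergent series.\<close>

lemma riemann_zeta_eq_remainder_sum:
  assumes "Re s > 0" "s \<noteq> 1"
  shows "(s - 1) * riemann_zeta s = 1 + zeta_remainder_sum 1 s"
proof (rule analytic_continuation_open[of "{s. Re s > 1}" "{s. Re s > 0} - {1}"
      "\<lambda>s. (s - 1) * riemann_zeta s" "\<lambda>s. 1 + zeta_remainder_sum 1 s"])
  show "open ({s. Re s > 0} - {1})"
    by (intro open_delete open_halfspace_Re_gt)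
  show "connected ({s. Re s > 0} - {1})"
    by (intro connected_open_delete open_halfspace_Re_gt convex_connected convex_halfspace_Re_gt) auto
  show "{s. Re s > 1} \<noteq> {}"
    by (auto intro: exI[of _ 2])
  show "(\<lambda>s. (s - 1) * riemann_zeta s) holomorphic_on {s. Re s > 0} - {1}"
    by (intro holomorphic_intros holomorphic_on_subset[OF riemann_zeta_holomorphic]) auto
  show "(\<lambda>s. 1 + zeta_remainder_sum 1 s) holomorphic_on {s. Re s > 0} - {1}"
    by (intro holomorphic_intros holomorphic_on_subset[OF holomorphic_zeta_remainder_sum]) auto
  show "(s - 1) * riemann_zeta s = 1 + zeta_remainder_sum 1 s" if "s \<in> {s. Re s > 1}" for s
  proof -
    have "riemann_zeta s = dirichlet_zeta s"
      using that by (intro sums_unique2[OF riemann_zeta_sums dirichlet_zeta_sums]) auto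
    then show ?thesis
      using that zeta_remainder_sum_eq[of s 1] by simp
  qed
qed (use assms in \<open>auto intro: open_halfspace_Re_gt\<close>)

section \<open>Zeta and the alternating series at real arguments\<close>

lemma real_zeta_sums:
  assumes "\<sigma> > 1"
  shows "(\<lambda>k. real (Suc k) powr - \<sigma>) sums real_zeta \<sigma>"
proof -
  have "(\<lambda>k. Re (1 / of_nat (Suc k) powr of_real \<sigma>)) sums real_zeta \<sigma>"
    unfolding real_zeta_def using assms by (intro sums_Re riemann_zeta_sums) simp
  also have "(\<lambda>k. Re (1 / of_nat (Suc k) powr of_real \<sigma>)) = (\<lambda>k. real (Suc k) powr - \<sigma>)"
  proof
    fix k
    have "1 / of_nat (Suc k) powr of_real \<sigma> = complex_of_real (real (Suc k) powr - \<sigma>)"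
      using powr_of_real[of "real (Suc k)" \<sigma>] by (simp add: powr_minus_divide)
    then show "Re (1 / of_nat (Suc k) powr of_real \<sigma>) = real (Suc k) powr - \<sigma>"
      by simp
  qed
  finally show ?thesis .
qed

text \<open>The remainders with K = 1 telescope up to a multiple of the partial sum. For \<sigma> <
  1 the subtracted power compensates the divergence of the partial sums.\<close>

lemma real_zeta_limit:
  assumes "\<sigma> > 0" "\<sigma> \<noteq> 1"
  shows "(\<lambda>N. (\<Sum>k<N. real (Suc k) powr - \<sigma>) - real (N + 1) powr (1 - \<sigma>) / (1 - \<sigma>)) \<longlonglongrightarrow> real_zeta \<sigma>"
proof -
  define r where "r = (\<lambda>n. real (n + 2) powr (1 - \<sigma>) - real (n + 1) powr (1 - \<sigma>) -
                        (1 - \<sigma>) * real (Suc n) powr - \<sigma>)"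
  have r: "zeta_remainder 1 n (of_real \<sigma>) = of_real (r n)" for n
    using powr_of_real[of "real (n + 2)" "1 - \<sigma>"] powr_of_real[of "real (n + 1)" "1 - \<sigma>"]
      powr_of_real[of "real (n + 1)" "- \<sigma>"]
    by (simp add: zeta_remainder_def r_def)
  have "summable (\<lambda>n. zeta_remainder 1 n (of_real \<sigma>))"
    using assms by (intro summable_norm_cancel[OF summable_norm_zeta_remainder]) auto
  then have "(\<lambda>n. zeta_remainder 1 n (of_real \<sigma>)) sums zeta_remainder_sum 1 (of_real \<sigma>)"
    unfolding zeta_remainder_sum_def by (rule summable_sums)
  also have "zeta_remainder_sum 1 (of_real \<sigma>) = (of_real \<sigma> - 1) * riemann_zeta (of_real \<sigma>) - 1"
    using assms by (subst riemann_zeta_eq_remainder_sum) auto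
  finally have "(\<lambda>n. Re (zeta_remainder 1 n (of_real \<sigma>))) sums
      Re ((of_real \<sigma> - 1) * riemann_zeta (of_real \<sigma>) - 1)"
    by (rule sums_Re)
  then have "r sums ((\<sigma> - 1) * real_zeta \<sigma> - 1)"
    by (simp only: r Re_complex_of_real) (simp add: real_zeta_def)
  then have "(\<lambda>N. (\<Sum>n<N. r n) + 1) \<longlonglongrightarrow> (\<sigma> - 1) * real_zeta \<sigma> - 1 + 1"
    unfolding sums_def by (intro tendsto_add tendsto_const)
  then have "(\<lambda>N. ((\<Sum>n<N. r n) + 1) / (\<sigma> - 1)) \<longlonglongrightarrow> (\<sigma> - 1) * real_zeta \<sigma> / (\<sigma> - 1)"
    using assms by (intro tendsto_divide) auto
  moreover have "((\<Sum>n<N. r n) + 1) / (\<sigma> - 1) =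
      (\<Sum>k<N. real (Suc k) powr - \<sigma>) - real (N + 1) powr (1 - \<sigma>) / (1 - \<sigma>)" for N
  proof -
    have "(\<Sum>n<N. real (n + 2) powr (1 - \<sigma>) - real (n + 1) powr (1 - \<sigma>)) =
        real (N + 1) powr (1 - \<sigma>) - 1"
      using sum_lessThan_telescope[of "\<lambda>n. real (n + 1) powr (1 - \<sigma>)" N] by simp
    then have "(\<Sum>n<N. r n) + 1 =
        real (N + 1) powr (1 - \<sigma>) - (1 - \<sigma>) * (\<Sum>k<N. real (Suc k) powr - \<sigma>)"
      unfolding r_def by (simp only: sum_subtractf sum_distrib_left)
    with assms show ?thesis
      by (simp add: divide_simps) (simp add: algebra_simps)
  qed
  ultimately show ?thesis
    using assms by simp
qed

text \<open>Leibniz' criterion; even partial sums are lower bounds, and the one with two terms is 1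
  - 2^(-\<sigma>) > 0.\<close>

lemma eta_summable:
  assumes "\<sigma> > 0"
  shows "summable (\<lambda>k. (-1) ^ k * real (Suc k) powr - \<sigma>)"
    and "(\<Sum>k. (-1) ^ k * real (Suc k) powr - \<sigma>) > 0"
proof -
  have lim: "(\<lambda>k. real (Suc k) powr - \<sigma>) \<longlonglongrightarrow> 0"
    using assms by real_asymp
  have mono: "real (Suc (Suc k)) powr - \<sigma> \<le> real (Suc k) powr - \<sigma>" for k
    using assms by (intro powr_mono2') auto
  show "summable (\<lambda>k. (-1) ^ k * real (Suc k) powr - \<sigma>)"
    by (rule summable_Leibniz'(1)[OF lim _ mono]) simp
  have "0 < 1 - 2 powr - \<sigma>"
    using powr_less_mono2_neg[of "- \<sigma>" 1 2] assms by simp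
  also have "\<dots> = (\<Sum>k<2 * 1. (-1) ^ k * real (Suc k) powr - \<sigma>)"
    by (simp add: numeral_2_eq_2)
  also have "\<dots> \<le> (\<Sum>k. (-1) ^ k * real (Suc k) powr - \<sigma>)"
    by (rule summable_Leibniz'(2)[OF lim _ mono]) simp
  finally show "(\<Sum>k. (-1) ^ k * real (Suc k) powr - \<sigma>) > 0" .
qed

text \<open>Changing signs at even integers subtracts their terms twice, that is 2^(1-\<sigma>)
  times a shorter partial sum. The corrected sums \<open>U\<close> keep this meaningful for \<sigma>
  < 1.\<close>

lemma eta_eq_zeta:
  assumes "\<sigma> > 0" "\<sigma> \<noteq> 1"
  shows "(\<Sum>k. (-1) ^ k * real (Suc k) powr - \<sigma>) = (1 - 2 powr (1 - \<sigma>)) * real_zeta \<sigma>"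
proof -
  define T where "T = (\<lambda>N. \<Sum>k<N. real (Suc k) powr - \<sigma>)"
  have odd: "filterlim (\<lambda>N. 2 * N + 1) at_top (sequentially :: nat filter)"
    by (rule filterlim_subseq) (simp add: strict_mono_def)
  define U where "U = (\<lambda>N. T N - real (N + 1) powr (1 - \<sigma>) / (1 - \<sigma>))"
  have double: "filterlim (\<lambda>N. 2 * N) at_top (sequentially :: nat filter)"
    by (rule filterlim_subseq) (simp add: strict_mono_def)
  have "(\<Sum>k<2 * N. (-1) ^ k * real (Suc k) powr - \<sigma>) = T (2 * N) - 2 powr (1 - \<sigma>) * T N" for N
  proof (induction N)
    case (Suc N)
    have "2 powr (1 - \<sigma>) * real (Suc N) powr - \<sigma> = 2 * real (2 * N + 2) powr - \<sigma>"
      using powr_mult[of 2 "real (Suc N)" "- \<sigma>"] by (simp add: powr_diff powr_minus_divide algebra_simps)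
    with Suc.IH show ?case
      by (simp add: T_def algebra_simps)
  qed (simp add: T_def)
  \<comment> \<open>\<open>U\<close> is taken at 2 N + 1 because its correction (2 N +
    2)^(1-\<sigma>) then cancels that of 2^(1-\<sigma>) \<open>U N\<close> exactly; the cost is one
    extra term, which tends to 0.\<close>
  also have "\<dots> N = U (2 * N + 1) - 2 powr (1 - \<sigma>) * U N - real (2 * N + 1) powr - \<sigma>" for N
  proof -
    have "2 powr (1 - \<sigma>) * real (N + 1) powr (1 - \<sigma>) = real (2 * N + 2) powr (1 - \<sigma>)"
      using powr_mult[of 2 "real (N + 1)" "1 - \<sigma>"] by (simp add: algebra_simps)
    then show ?thesis
      by (simp add: U_def T_def right_diff_distrib)
  qed
  finally have eq: "(\<Sum>k<2 * N. (-1) ^ k * real (Suc k) powr - \<sigma>) =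
      U (2 * N + 1) - 2 powr (1 - \<sigma>) * U N - real (2 * N + 1) powr - \<sigma>" for N .
  have U: "U \<longlonglongrightarrow> real_zeta \<sigma>"
    unfolding U_def T_def using assms by (rule real_zeta_limit)
  have "(\<lambda>N. real (2 * N + 1) powr - \<sigma>) \<longlonglongrightarrow> 0"
    using assms by real_asymp
  with U have "(\<lambda>N. \<Sum>k<2 * N. (-1) ^ k * real (Suc k) powr - \<sigma>) \<longlonglongrightarrow>
      real_zeta \<sigma> - 2 powr (1 - \<sigma>) * real_zeta \<sigma> - 0"
    unfolding eq
    by (intro tendsto_diff tendsto_mult tendsto_const filterlim_compose[OF U odd])
  moreover have "(\<lambda>N. \<Sum>k<2 * N. (-1) ^ k * real (Suc k) powr - \<sigma>) \<longlonglongrightarrow>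
      (\<Sum>k. (-1) ^ k * real (Suc k) powr - \<sigma>)"
    using summable_LIMSEQ[OF eta_summable(1)[OF assms(1)]] double by (rule filterlim_compose)
  ultimately have "real_zeta \<sigma> - 2 powr (1 - \<sigma>) * real_zeta \<sigma> - 0 = (\<Sum>k. (-1) ^ k * real (Suc k) powr - \<sigma>)"
    by (rule LIMSEQ_unique)
  then show ?thesis
    by (simp add: left_diff_distrib)
qed

theorem corollary7p2:
  fixes \<delta> \<sigma> :: real
  assumes "\<delta> > 0"
  shows "(0 < \<sigma> \<and> \<sigma> < 1 \<longrightarrow>
            sharp_constant (hilbert_lower_bound \<sigma> \<delta>)
              ((2 - 2 powr (2 - \<sigma>)) * real_zeta \<sigma> / \<delta> powr \<sigma>)) \<and>
         (\<sigma> = 1 \<longrightarrow>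
            sharp_constant (hilbert_lower_bound \<sigma> \<delta>) (ln 4 / \<delta>)) \<and>
         (1 < \<sigma> \<and> \<sigma> < 2 \<longrightarrow>
            sharp_constant (hilbert_lower_bound \<sigma> \<delta>)
              ((2 - 2 powr (2 - \<sigma>)) * real_zeta \<sigma> / \<delta> powr \<sigma>) \<and>
            sharp_constant (hilbert_upper_bound \<sigma> \<delta>)
              (2 * real_zeta \<sigma> / \<delta> powr \<sigma>))"
proof -
  \<comment> \<open>The lower constant is twice the Dirichlet eta value over \<delta>^\<sigma>; the
    zeta expression and ln 4 = 2 ln 2 are evaluations of it.\<close>
  have lower: "sharp_constant (hilbert_lower_bound \<sigma> \<delta>)
      (2 * (\<Sum>k. (-1) ^ k * real (Suc k) powr - \<sigma>) / \<delta> powr \<sigma>)" if "\<sigma> > 0"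
    using that assms eta_summable[OF that] by (intro sharp_hilbert_lower_bound summable_sums)
  have lower_zeta: "sharp_constant (hilbert_lower_bound \<sigma> \<delta>)
      ((2 - 2 powr (2 - \<sigma>)) * real_zeta \<sigma> / \<delta> powr \<sigma>)" if "\<sigma> > 0" "\<sigma> \<noteq> 1"
  proof -
    have "2 * ((1 - 2 powr (1 - \<sigma>)) * real_zeta \<sigma>) = (2 - 2 powr (2 - \<sigma>)) * real_zeta \<sigma>"
      by (simp add: powr_diff algebra_simps)
    with lower[OF that(1)] show ?thesis
      by (simp only: eta_eq_zeta[OF that])
  qed
  have lower_1: "sharp_constant (hilbert_lower_bound \<sigma> \<delta>) (ln 4 / \<delta>)" if "\<sigma> = 1"
  proof -
    have "(\<lambda>k. (-1) ^ k * real (Suc k) powr - \<sigma>) sums ln 2"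
      using alternating_harmonic_series_sums that by (simp add: powr_minus divide_inverse)
    moreover have "2 * ln 2 = ln (4::real)"
      using ln_realpow[of 2 2] by simp
    ultimately show ?thesis
      using lower that assms by (simp add: sums_iff)
  qed
  have upper: "sharp_constant (hilbert_upper_bound \<sigma> \<delta>) (2 * real_zeta \<sigma> / \<delta> powr \<sigma>)" if "\<sigma> > 1"
  proof (rule sharp_hilbert_upper_bound)
    show "real_zeta \<sigma> > 0"
      using real_zeta_sums[OF that] suminf_pos[of "\<lambda>k. real (Suc k) powr - \<sigma>"] by (simp add: sums_iff)
  qed (use that assms real_zeta_sums in auto)
  show ?thesis
    using lower_zeta lower_1 upper by simp
qed

end
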